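(* Let $1<p<\infty$. Then $C^{\mathbb{Z},\mathrm{u}}_{1,p}>C_{1,p}$.
   Context: An interval in $\mathbb{Z}$ is a nonempty finite set of consecutive integers. For $f:\mathbb{Z}\to\mathbb{R}$ the discrete uncentered maximal function is $\mathcal{M}f(n)=\sup_{I\ni n}\frac1{|I|}\sum_{i\in I}|f(i)|$, the supremum being over all intervals $I\subset\mathbb{Z}$ containing $n$, with $|I|$ the cardinality of $I$. The discrete derivative is $f'(n)=f(n+1)-f(n)$. For $S\subseteq\mathbb{Z}$, $\chi_S$ is its characteristic function. $C_{1,p}$ is the smallest number such that $\|(\mathcal{M}\chi_S)'\|_{\ell^p(\mathbb{Z})}\le C_{1,p}\|\chi_S'\|_{\ell^p(\mathbb{Z})}$ for all $S\subseteq\mathbb{Z}$ with $\|\chi_S'\|_{\ell^p(\mathbb{Z})}<\infty$. $C^{\mathbb{Z},\mathrm{u}}_{1,p}$ is the smallest constant such that $\|(\mathcal{M}f)'\|_{\ell^p(\mathbb{Z})}\le C^{\mathbb{Z},\mathrm{u}}_{1,p}\|f'\|_{\ell^p(\mathbb{Z})}$ for every $f:\mathbb{Z}\to\mathbb{R}$ with $\|f'\|_{\ell^p(\mathbb{Z})}<\infty$ (and with $\mathcal{M}f$ finite, so that $(\mathcal{M}f)'$ is defined). *)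

theory Defs
  imports "HOL-Analysis.Analysis"
begin

definition int_interval :: "int set \<Rightarrow> bool" where
  "int_interval I \<longleftrightarrow> (\<exists>a b. a \<le> b \<and> I = {a..b})"

definition avg :: "(int \<Rightarrow> real) \<Rightarrow> int set \<Rightarrow> real" where
  "avg f I = (\<Sum>i\<in>I. \<bar>f i\<bar>) / real (card I)"

(* The real supremum below is only meaningful where the averages are bounded above,
   which is what maximal_finite expresses. *)
definition maximal :: "(int \<Rightarrow> real) \<Rightarrow> int \<Rightarrow> real" where
  "maximal f n = (SUP I\<in>{I. int_interval I \<and> n \<in> I}. avg f I)"

definition maximal_finite :: "(int \<Rightarrow> real) \<Rightarrow> bool" where
  "maximal_finite f \<longleftrightarrow> (\<forall>n. bdd_above (avg f ` {I. int_interval I \<and> n \<in> I}))"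

definition dderiv :: "(int \<Rightarrow> real) \<Rightarrow> int \<Rightarrow> real" where
  "dderiv f n = f (n + 1) - f n"

(* Extended-valued: infinite if g is not p-summable. *)
definition lp_norm :: "real \<Rightarrow> (int \<Rightarrow> real) \<Rightarrow> ennreal" where
  "lp_norm p g =
     (if (\<lambda>n. \<bar>g n\<bar> powr p) summable_on UNIV
      then ennreal ((\<Sum>\<^sub>\<infinity>n. \<bar>g n\<bar> powr p) powr (1 / p))
      else \<infinity>)"

(* Both best constants are infima in [0,\<infinity>], with value \<infinity> if no finite constant works.
   The lemmas at the end show that the infima are attained, i.e. that they are the
   smallest constants. *)
definition C_char :: "real \<Rightarrow> ennreal" where
  "C_char p = Inf {C. \<forall>S. lp_norm p (dderiv (indicator S)) < \<infinity> \<longrightarrow>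
     lp_norm p (dderiv (maximal (indicator S))) \<le> C * lp_norm p (dderiv (indicator S))}"

definition C_unc :: "real \<Rightarrow> ennreal" where
  "C_unc p = Inf {C. \<forall>f. lp_norm p (dderiv f) < \<infinity> \<and> maximal_finite f \<longrightarrow>
     lp_norm p (dderiv (maximal f)) \<le> C * lp_norm p (dderiv f)}"

lemma maximal_finite_indicator: "maximal_finite (indicator S)"
  unfolding maximal_finite_def
proof (intro allI bdd_aboveI2)
  fix n I
  have "(\<Sum>i\<in>I. \<bar>indicator S i :: real\<bar>) \<le> (\<Sum>i\<in>I. 1)"
    by (intro sum_mono) (auto simp: indicator_def)
  then show "avg (indicator S) I \<le> 1"
    by (cases "card I = 0") (auto simp: avg_def divide_simps)
qed

lemma lp_norm_eq_0_iff: "lp_norm p g = 0 \<longleftrightarrow> g = (\<lambda>_. 0)"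
proof
  assume 0: "lp_norm p g = 0"
  then have s: "(\<lambda>n. \<bar>g n\<bar> powr p) summable_on UNIV"
    by (auto simp: lp_norm_def split: if_splits)
  with 0 have "ennreal ((\<Sum>\<^sub>\<infinity>n. \<bar>g n\<bar> powr p) powr (1 / p)) = 0"
    by (simp add: lp_norm_def)
  then have z: "(\<Sum>\<^sub>\<infinity>n. \<bar>g n\<bar> powr p) = 0"
    by (simp add: ennreal_eq_0_iff not_less)
  have "\<bar>g n\<bar> powr p = 0" for n
    using nonneg_infsum_le_0D[OF _ s, of n] z by simp
  then show "g = (\<lambda>_. 0)" by (auto simp: fun_eq_iff)
qed (simp add: lp_norm_def)

lemma maximal_const: "maximal (\<lambda>_. c) n = \<bar>c\<bar>"
proof -
  have "avg (\<lambda>_. c) I = \<bar>c\<bar>" if "int_interval I" for I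
    using that by (auto simp: avg_def int_interval_def)
  moreover have "int_interval {n..n}" unfolding int_interval_def by blast
  then have "{I. int_interval I \<and> n \<in> I} \<noteq> {}" by force
  ultimately show ?thesis by (simp add: maximal_def)
qed

lemma dderiv_eq_0_imp_const:
  assumes "dderiv f = (\<lambda>_. 0)" shows "f = (\<lambda>_. f 0)"
proof
  have s: "f (n + 1) = f n" for n
    using fun_cong[OF assms, of n] by (simp add: dderiv_def)
  show "f n = f 0" for n
    by (induction n rule: int_induct[where k = 0]) (use s[of "_ - 1"] in \<open>auto simp: s\<close>)
qed

lemma lp_norm_dderiv_maximal_eq_0:
  assumes "lp_norm p (dderiv f) = 0" shows "lp_norm p (dderiv (maximal f)) = 0"
proof -
  have "f = (\<lambda>_. f 0)" using assms by (simp only: lp_norm_eq_0_iff dderiv_eq_0_imp_const)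
  then have "maximal f = (\<lambda>n. \<bar>f 0\<bar>)" by (metis maximal_const)
  then show ?thesis by (simp add: lp_norm_eq_0_iff dderiv_def fun_eq_iff)
qed

lemma le_Inf_const_mult:
  fixes x y :: "'a \<Rightarrow> ennreal"
  assumes "a \<in> A" "x a < \<infinity>" "x a = 0 \<Longrightarrow> y a = 0"
  shows "y a \<le> Inf {C. \<forall>b\<in>A. y b \<le> C * x b} * x a"
proof (cases "x a = 0")
  case False
  have "y a / x a \<le> Inf {C. \<forall>b\<in>A. y b \<le> C * x b}"
    using assms False by (intro Inf_greatest divide_le_posI_ennreal)
      (auto simp: mult.commute zero_less_iff_neq_zero)
  then have "y a / x a * x a \<le> Inf {C. \<forall>b\<in>A. y b \<le> C * x b} * x a"
    by (rule mult_right_mono) simp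
  then show ?thesis using assms False
    by (simp add: ennreal_divide_times ennreal_mult_divide_eq)
qed (use assms in simp)

lemma C_char_bound:
  assumes "lp_norm p (dderiv (indicator S)) < \<infinity>"
  shows "lp_norm p (dderiv (maximal (indicator S))) \<le> C_char p * lp_norm p (dderiv (indicator S))"
  using le_Inf_const_mult[of S "{S. lp_norm p (dderiv (indicator S)) < \<infinity>}"
      "\<lambda>S. lp_norm p (dderiv (indicator S))" "\<lambda>S. lp_norm p (dderiv (maximal (indicator S)))"]
    assms lp_norm_dderiv_maximal_eq_0
  by (simp add: C_char_def)

lemma C_unc_bound:
  assumes "lp_norm p (dderiv f) < \<infinity>" "maximal_finite f"
  shows "lp_norm p (dderiv (maximal f)) \<le> C_unc p * lp_norm p (dderiv f)"
  using le_Inf_const_mult[of f "{f. lp_norm p (dderiv f) < \<infinity> \<and> maximal_finite f}"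
      "\<lambda>f. lp_norm p (dderiv f)" "\<lambda>f. lp_norm p (dderiv (maximal f))"]
    assms lp_norm_dderiv_maximal_eq_0
  by (simp add: C_unc_def)

end

theory Submission
  imports Defs
begin

text \<open>
  Let $K = \sum_{n \ge 1} (n(n+1))^{-p}$, the $p$-th power of the quotient attained by the
  characteristic function of a point. It is optimal among characteristic functions: the maximal
  function is convex on each gap of $S$ and at least $1/(n+1)$ at distance $n$ from $S$, so its
  decrements going away from an endpoint of the gap are decreasing and their partial sums are at most
  those of $1/(n(n+1))$, and majorization bounds the contribution of each boundary edge of $S$ by $K$.
  It is not optimal among all functions: replacing the values of the point mass at $\pm 1$ by
  $\varepsilon$ multiplies the first decrement $1/2$ by $1 - \varepsilon$ and diminishes none of the
  others, whereas the right-hand side becomes $K((1-\varepsilon)^p + \varepsilon^p)$. As $p > 1$,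
  the term $K \varepsilon^p$ is of smaller order than the gain
  $(K - 2^{-p})(1 - (1-\varepsilon)^p) \ge (K - 2^{-p})\varepsilon$.
\<close>

section \<open>Norm bounds by finite sums; averages, reflection and convexity of maximal
  functions\<close>

text \<open>Boundedness of all finite sums already yields summability, so later estimates can stay
  with finite index sets and need no separate case for an infinite norm.\<close>

lemma lp_norm_le_iff:
  assumes "p > 0" "c \<ge> 0"
  shows "lp_norm p g \<le> ennreal (c powr (1 / p)) \<longleftrightarrow>
    (\<forall>F. finite F \<longrightarrow> (\<Sum>n\<in>F. \<bar>g n\<bar> powr p) \<le> c)"
proof
  assume L: "lp_norm p g \<le> ennreal (c powr (1 / p))"
  then have s: "(\<lambda>n. \<bar>g n\<bar> powr p) summable_on UNIV"
    by (auto simp: lp_norm_def top_unique split: if_splits)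
  with L have "(\<Sum>\<^sub>\<infinity>n. \<bar>g n\<bar> powr p) powr (1 / p) \<le> c powr (1 / p)"
    by (simp add: lp_norm_def)
  then have "(\<Sum>\<^sub>\<infinity>n. \<bar>g n\<bar> powr p) \<le> c"
    using assms powr_less_mono2[of "1 / p" c "\<Sum>\<^sub>\<infinity>n. \<bar>g n\<bar> powr p"] by force
  moreover have "(\<Sum>n\<in>F. \<bar>g n\<bar> powr p) \<le> (\<Sum>\<^sub>\<infinity>n. \<bar>g n\<bar> powr p)" if "finite F" for F
    using that s by (intro finite_sum_le_infsum) auto
  ultimately show "\<forall>F. finite F \<longrightarrow> (\<Sum>n\<in>F. \<bar>g n\<bar> powr p) \<le> c"
    by (meson order_trans)
next
  assume R: "\<forall>F. finite F \<longrightarrow> (\<Sum>n\<in>F. \<bar>g n\<bar> powr p) \<le> c"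
  have s: "(\<lambda>n. \<bar>g n\<bar> powr p) summable_on UNIV"
    by (rule nonneg_bdd_above_summable_on) (use R in \<open>auto intro!: bdd_aboveI2\<close>)
  have "(\<Sum>\<^sub>\<infinity>n. \<bar>g n\<bar> powr p) \<le> c"
    by (rule infsum_le_finite_sums) (use s R in auto)
  then show "lp_norm p g \<le> ennreal (c powr (1 / p))"
    using s assms by (auto simp: lp_norm_def intro!: ennreal_leI powr_mono2 infsum_nonneg)
qed

lemma int_interval_atLeastAtMost [simp]: "a \<le> b \<Longrightarrow> int_interval {a..b}"
  by (auto simp: int_interval_def)

lemma maximal_leI:
  assumes "\<And>a b. a \<le> n \<Longrightarrow> n \<le> b \<Longrightarrow> avg f {a..b} \<le> c"
  shows "maximal f n \<le> c"
  unfolding maximal_def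
proof (rule cSUP_least)
  show "{I. int_interval I \<and> n \<in> I} \<noteq> {}"
    using int_interval_atLeastAtMost[of n n] by force
qed (auto simp: int_interval_def intro: assms)

lemma avg_le_maximal:
  assumes "maximal_finite f" "a \<le> n" "n \<le> b"
  shows "avg f {a..b} \<le> maximal f n"
  unfolding maximal_def
  using assms by (intro cSUP_upper) (auto simp: maximal_finite_def)

lemma avg_nonneg: "0 \<le> avg f I"
  by (auto simp: avg_def sum_nonneg)

lemma maximal_nonneg: "maximal_finite f \<Longrightarrow> 0 \<le> maximal f n"
  using avg_le_maximal[of f n n n] avg_nonneg[of f "{n..n}"] by linarith

lemma avg_le_bound:
  assumes "\<And>i. \<bar>f i\<bar> \<le> c"
  shows "avg f {a..b} \<le> c"
proof (cases "a \<le> b")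
  case True
  have "(\<Sum>i\<in>{a..b}. \<bar>f i\<bar>) \<le> (\<Sum>i\<in>{a..b}. c)"
    by (intro sum_mono assms)
  then show ?thesis
    using True by (simp add: avg_def pos_divide_le_eq mult.commute)
next
  case False
  \<comment> \<open>The interval is empty and its average is 0 / 0 = 0; \<open>c\<close> is
    nonnegative because it bounds an absolute value.\<close>
  then show ?thesis using assms[of 0] by (simp add: avg_def)
qed

lemma maximal_finite_bounded:
  assumes "\<And>i. \<bar>f i\<bar> \<le> c"
  shows "maximal_finite f"
  unfolding maximal_finite_def int_interval_def
  by (intro allI bdd_aboveI2[where M = c]) (auto intro: avg_le_bound[OF assms])

lemma avg_reflect: "avg (\<lambda>i. f (- i)) I = avg f (uminus ` I)"
  by (simp add: avg_def sum.reindex card_image)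

text \<open>Negation is an involution carrying the intervals around \<open>n\<close> onto those
  around \<open>- n\<close>. It will turn ascents into descents.\<close>

lemma maximal_reflect: "maximal (\<lambda>i. f (- i)) n = maximal f (- n)"
proof -
  have *: "uminus ` I \<in> {I. int_interval I \<and> - n \<in> I}"
    if "I \<in> {I. int_interval I \<and> n \<in> I}" for I and n :: int
    using that by (auto simp: int_interval_def)
  have "{I. int_interval I \<and> - n \<in> I} = (`) uminus ` {I. int_interval I \<and> n \<in> I}"
  proof (intro equalityI subsetI)
    fix J assume "J \<in> {I. int_interval I \<and> - n \<in> I}"
    then have "uminus ` J \<in> {I. int_interval I \<and> n \<in> I}"
      using *[of J "- n"] by simp
    moreover have "J = uminus ` (uminus ` J)"
      by (simp add: image_image)
    ultimately show "J \<in> (`) uminus ` {I. int_interval I \<and> n \<in> I}"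
      by blast
  qed (use * in blast)
  then show ?thesis
    by (simp add: maximal_def avg_reflect image_image)
qed

text \<open>An interval with \<open>q\<close> in its interior also contains both neighbours of
  \<open>q\<close>. A longer interval ending at \<open>q\<close> keeps its mass when
  \<open>q\<close> is dropped and loses none when extended past \<open>q\<close>; convexity of 1/x
  compares the three averages.\<close>

lemma maximal_convex_at_zero:
  assumes fin: "maximal_finite f" and "f q = 0"
  shows "2 * maximal f q \<le> maximal f (q - 1) + maximal f (q + 1)"
proof -
  have "maximal f q \<le> (maximal f (q - 1) + maximal f (q + 1)) / 2"
  proof (rule maximal_leI)
    fix a b assume ab: "a \<le> q" "q \<le> b"
    define k where "k = (\<Sum>i\<in>{a..b}. \<bar>f i\<bar>)"
    define m where "m = real_of_int (b - a)"
    have k0: "k \<ge> 0" by (simp add: k_def sum_nonneg)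
    have avg: "avg f {a..b} = k / (m + 1)"
      using ab by (simp add: avg_def k_def m_def)
    \<comment> \<open>Here \<open>m\<close> counts the points left after dropping the endpoint
      \<open>q\<close>, and \<open>m + 2\<close> those after extending one point beyond it. The
      claim is midpoint convexity of 1/x at \<open>m + 1\<close>.\<close>
    have ends: "2 * (k / (m + 1)) \<le> k / m + k / (m + 2)" if "m > 0"
    proof -
      have "1 / m + 1 / (m + 2) - 2 / (m + 1) = 2 / (m * (m + 1) * (m + 2))"
      proof -
        have "m \<noteq> 0" "m + 1 \<noteq> 0" "m + 2 \<noteq> 0" using that by auto
        then show ?thesis by (simp add: divide_simps) (simp add: algebra_simps)
      qed
      also have "\<dots> \<ge> 0" using that by simp
      finally have "k * (2 / (m + 1)) \<le> k * (1 / m + 1 / (m + 2))"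
        using k0 by (intro mult_left_mono) auto
      then show ?thesis by (simp add: distrib_left mult.commute)
    qed
    consider "a < q" "q < b" | "a = q" "b = q" | "a < q" "b = q" | "a = q" "q < b"
      using ab by linarith
    then show "avg f {a..b} \<le> (maximal f (q - 1) + maximal f (q + 1)) / 2"
    proof cases
      case 1
      then show ?thesis
        using avg_le_maximal[OF fin, of a "q - 1" b] avg_le_maximal[OF fin, of a "q + 1" b]
        by simp
    next
      case 2
      then show ?thesis
        using maximal_nonneg[OF fin] assms by (simp add: avg_def)
    next
      case 3
      have "{a..b} = insert q {a..q - 1}" using 3 by auto
      then have "k = (\<Sum>i\<in>{a..q - 1}. \<bar>f i\<bar>)"
        using assms by (simp add: k_def)
      then have "avg f {a..q - 1} = k / m"
        using 3 by (simp add: avg_def m_def)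
      then have 1: "k / m \<le> maximal f (q - 1)"
        using avg_le_maximal[OF fin, of a "q - 1" "q - 1"] 3 by simp
      have "k / (m + 2) \<le> avg f {a..q + 1}"
        unfolding avg_def k_def m_def using 3
        by (auto intro!: divide_mono sum_mono2 sum_nonneg)
      then have 2: "k / (m + 2) \<le> maximal f (q + 1)"
        using avg_le_maximal[OF fin, of a "q + 1" "q + 1"] 3 by simp
      have "m > 0" using 3 by (simp add: m_def)
      from ends[OF this] show ?thesis using 1 2 by (simp add: avg mult.commute)
    next
      case 4
      have "{a..b} = insert q {q + 1..b}" using 4 by auto
      then have "k = (\<Sum>i\<in>{q + 1..b}. \<bar>f i\<bar>)"
        using assms by (simp add: k_def)
      then have "avg f {q + 1..b} = k / m"
        using 4 by (simp add: avg_def m_def)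
      then have 1: "k / m \<le> maximal f (q + 1)"
        using avg_le_maximal[OF fin, of "q + 1" "q + 1" b] 4 by simp
      have "k / (m + 2) \<le> avg f {q - 1..b}"
        unfolding avg_def k_def m_def using 4
        by (auto intro!: divide_mono sum_mono2 sum_nonneg)
      then have 2: "k / (m + 2) \<le> maximal f (q - 1)"
        using avg_le_maximal[OF fin, of "q - 1" "q - 1" b] 4 by simp
      have "m > 0" using 4 by (simp add: m_def)
      from ends[OF this] show ?thesis using 1 2 by (simp add: avg mult.commute)
    qed
  qed
  then show ?thesis by simp
qed

section \<open>The slopes of the maximal function of a point mass\<close>

text \<open>
  With index shifted by one: the decrement from $j$ to $j+1$ of the maximal function
  $n \mapsto 1/(|n|+1)$ of a point mass at $0$.
\<close>
definition delta_slope :: "nat \<Rightarrow> real" where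
  "delta_slope j = 1 / ((real j + 1) * (real j + 2))"

lemma delta_slope_eq: "delta_slope j = 1 / (real j + 1) - 1 / (real j + 2)"
  by (simp add: delta_slope_def divide_simps)

lemma delta_slope_pos: "delta_slope j > 0"
  by (simp add: delta_slope_def)

lemma sum_delta_slope: "(\<Sum>j<k. delta_slope j) = 1 - 1 / (real k + 1)"
  by (induction k) (simp_all add: delta_slope_eq add.commute)

text \<open>The slopes telescope to partial sums of at most 1, and each is at most 1, so taking p-th
  powers does not increase them.\<close>

lemma summable_delta_slope_powr:
  assumes "1 < p"
  shows "summable (\<lambda>j. delta_slope j powr p)"
proof (rule summable_comparison_test')
  show "summable delta_slope"
  proof (rule bounded_imp_summable)
    show "(\<Sum>j\<le>n. delta_slope j) \<le> 1" for n
      unfolding lessThan_Suc_atMost[symmetric] sum_delta_slope by simp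
  qed (simp add: delta_slope_pos less_imp_le)
  fix j
  have "delta_slope j \<le> 1"
    by (simp add: delta_slope_def divide_simps) (simp add: algebra_simps)
  then have "delta_slope j powr p \<le> delta_slope j powr 1"
    using assms delta_slope_pos[of j] by (intro powr_mono') auto
  then show "norm (delta_slope j powr p) \<le> delta_slope j"
    using delta_slope_pos[of j] by simp
qed

section \<open>Majorization for p-th powers\<close>

text \<open>This is Young's inequality for \<open>x\<close> and \<open>y powr (p - 1)\<close> with
  the conjugate exponents \<open>p\<close> and \<open>p / (p - 1)\<close>, rearranged.\<close>

lemma powr_above_tangent:
  fixes x y p :: real
  assumes "1 < p" "0 \<le> x" "0 \<le> y"
  shows "p * y powr (p - 1) * (x - y) \<le> x powr p - y powr p"
proof (cases "y = 0")
  case False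
  then have y: "y > 0" using assms by simp
  have eq: "y powr (p - 1) * y = y powr p"
    using y by (simp add: powr_diff)
  have "x * y powr (p - 1) \<le> x powr p / p + (y powr (p - 1)) powr (p / (p - 1)) / (p / (p - 1))"
    using assms by (intro Youngs_inequality) (auto simp: field_simps)
  also have "(y powr (p - 1)) powr (p / (p - 1)) = y powr p"
    using assms by (simp add: powr_powr)
  finally have "p * (x * y powr (p - 1)) \<le> p * (x powr p / p + y powr p / (p / (p - 1)))"
    using assms by (intro mult_left_mono) auto
  also have "\<dots> = x powr p + (p - 1) * y powr p"
    using assms by (simp add: field_simps)
  finally show ?thesis
    using eq by (simp add: algebra_simps)
qed (use assms in simp)

lemma sum_antitone_weights_nonneg:
  fixes w x :: "nat \<Rightarrow> real"
  assumes "\<And>j. j < L \<Longrightarrow> w j \<ge> 0" "\<And>j. Suc j < L \<Longrightarrow> w (Suc j) \<le> w j"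
    and "\<And>k. k \<le> L \<Longrightarrow> (\<Sum>j<k. x j) \<ge> 0"
  shows "(\<Sum>j<L. w j * x j) \<ge> 0"
proof -
  \<comment> \<open>Abel summation as an induction: the last weight times the unweighted partial sum
    is a lower bound. As that sum is nonnegative, passing to the next, smaller weight preserves the
    bound.\<close>
  have "(\<Sum>j<Suc k. w j * x j) \<ge> w k * (\<Sum>j<Suc k. x j)" if "Suc k \<le> L" for k
    using that
  proof (induction k)
    case (Suc k)
    have "w (Suc k) * (\<Sum>j<Suc k. x j) \<le> w k * (\<Sum>j<Suc k. x j)"
      using Suc.prems by (intro mult_right_mono assms) auto
    then have "w (Suc k) * (\<Sum>j<Suc k. x j) \<le> (\<Sum>j<Suc k. w j * x j)"
      using Suc by auto
    then show ?case
      by (simp add: sum.lessThan_Suc[of _ "Suc k"] distrib_left del: sum.lessThan_Suc)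
  qed simp
  moreover have "w k * (\<Sum>j<Suc k. x j) \<ge> 0" if "Suc k \<le> L" for k
    using that assms by (intro mult_nonneg_nonneg) (auto simp del: sum.lessThan_Suc)
  ultimately show ?thesis
    by (cases L) (force simp del: sum.lessThan_Suc intro: order_trans)+
qed

text \<open>Karamata's argument: the tangent slopes at \<open>d j\<close> decrease in
  \<open>j\<close>, so by Abel summation the differences \<open>e j - d j\<close> weighted with them
  have a nonnegative sum, and the tangent bound replaces them by differences of p-th powers.\<close>

lemma sum_powr_le_of_majorized:
  fixes d e :: "nat \<Rightarrow> real"
  assumes "1 < p" "\<And>j. j < L \<Longrightarrow> 0 \<le> d j" "\<And>j. j < L \<Longrightarrow> 0 \<le> e j"
    and "\<And>j. Suc j < L \<Longrightarrow> d (Suc j) \<le> d j"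
    and "\<And>k. k \<le> L \<Longrightarrow> (\<Sum>j<k. d j) \<le> (\<Sum>j<k. e j)"
  shows "(\<Sum>j<L. d j powr p) \<le> (\<Sum>j<L. e j powr p)"
proof -
  have "0 \<le> (\<Sum>j<L. (p * d j powr (p - 1)) * (e j - d j))"
    using assms by (intro sum_antitone_weights_nonneg)
      (auto simp: sum_subtractf intro!: mult_left_mono powr_mono2)
  also have "\<dots> \<le> (\<Sum>j<L. e j powr p - d j powr p)"
    using assms by (intro sum_mono powr_above_tangent) auto
  finally show ?thesis by (simp add: sum_subtractf)
qed

section \<open>Upper bound for characteristic functions\<close>

lemma maximal_indicator_le_1: "maximal (indicator S) n \<le> 1"
  by (intro maximal_leI avg_le_bound) (simp add: indicator_def)

lemma maximal_indicator_lower: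
  assumes "s \<in> S"
  shows "1 / (real j + 1) \<le> maximal (indicator S) (s + int j)"
proof -
  have "(\<Sum>i\<in>{s}. \<bar>indicator S i\<bar> :: real) \<le> (\<Sum>i\<in>{s..s + int j}. \<bar>indicator S i\<bar>)"
    by (intro sum_mono2) auto
  then have "1 / (real j + 1) \<le> avg (indicator S) {s..s + int j}"
    using assms by (auto simp: avg_def intro!: divide_right_mono)
  also have "\<dots> \<le> maximal (indicator S) (s + int j)"
    by (intro avg_le_maximal maximal_finite_indicator) auto
  finally show ?thesis .
qed

text \<open>By convexity on the gap, a descent at the last step forces descents at all earlier ones.
  The first \<open>k\<close> of them telescope to \<open>M s - M (s + int k)\<close>, at most
  \<open>1 - 1 / (real k + 1)\<close>, which is the majorization required.\<close>

lemma sum_descent_le: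
  fixes S :: "int set"
  defines "M \<equiv> maximal (indicator S)"
  assumes p: "1 < p" and s: "s \<in> S" and gap: "{s<..s + int L} \<inter> S = {}"
    and desc: "L > 0 \<Longrightarrow> M (s + int L) \<le> M (s + int L - 1)"
  shows "(\<Sum>j<L. \<bar>dderiv M (s + int j)\<bar> powr p) \<le> (\<Sum>j<L. delta_slope j powr p)"
proof -
  define d where "d j = M (s + int j) - M (s + int j + 1)" for j
  have anti: "d (Suc j) \<le> d j" if "Suc j < L" for j
  proof -
    have "s + int (Suc j) \<in> {s<..s + int L}" using that by auto
    then have "s + int (Suc j) \<notin> S" using gap by blast
    then show ?thesis
      using maximal_convex_at_zero[OF maximal_finite_indicator[of S], of "s + int (Suc j)"]
      by (simp add: d_def M_def algebra_simps)
  qed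
  have nonneg: "0 \<le> d j" if "j < L" for j
  proof -
    have "d (L - 1) \<le> d j"
    proof (rule inc_induct[of j "L - 1"])
      fix i assume "i < L - 1" "d (L - 1) \<le> d (Suc i)"
      then show "d (L - 1) \<le> d i" using anti[of i] by linarith
    qed (use that in auto)
    moreover have "0 \<le> d (L - 1)"
      using desc that by (simp add: d_def of_nat_diff algebra_simps)
    ultimately show ?thesis by simp
  qed
  have "(\<Sum>j<k. d j) = M s - M (s + int k)" for k
    by (induction k) (simp_all add: d_def algebra_simps)
  then have "(\<Sum>j<k. d j) \<le> (\<Sum>j<k. delta_slope j)" for k
    using maximal_indicator_le_1[of S s] maximal_indicator_lower[OF s, of k]
    by (simp add: sum_delta_slope M_def)
  then have "(\<Sum>j<L. d j powr p) \<le> (\<Sum>j<L. delta_slope j powr p)"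
    using anti nonneg delta_slope_pos
    by (intro sum_powr_le_of_majorized p) (auto simp: less_imp_le)
  moreover have "\<bar>dderiv M (s + int j)\<bar> = d j" if "j < L" for j
    using nonneg[OF that] by (simp add: d_def dderiv_def)
  ultimately show ?thesis by simp
qed

text \<open>Some interval around \<open>n\<close> has an average above the maximal function at
  \<open>n + 1\<close>. It cannot contain \<open>n + 1\<close>, so it ends at \<open>n\<close>, and
  having positive average it meets \<open>S\<close>; its last point in \<open>S\<close> is the one
  sought.\<close>

lemma last_point_before_descent:
  assumes "maximal (indicator S) (n + 1) < maximal (indicator S) n"
  shows "\<exists>s\<in>S. s \<le> n \<and> {s<..n + 1} \<inter> S = {}"
proof -
  let ?M = "maximal (indicator S)"
  have "\<exists>a b. a \<le> n \<and> n \<le> b \<and> ?M (n + 1) < avg (indicator S) {a..b}"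
    using assms maximal_leI[of n "indicator S" "?M (n + 1)"] by (meson not_less)
  then obtain a b where ab: "a \<le> n" "n \<le> b" and gt: "?M (n + 1) < avg (indicator S) {a..b}"
    by blast
  have "b = n"
    using avg_le_maximal[OF maximal_finite_indicator, of a "n + 1" b S] ab gt by fastforce
  have "0 < avg (indicator S) {a..b}"
    using gt maximal_nonneg[OF maximal_finite_indicator, of S "n + 1"] by linarith
  then have "{a..n} \<inter> S \<noteq> {}"
    using \<open>b = n\<close> by (force simp: avg_def indicator_def intro: ccontr)
  define s where "s = Max ({a..n} \<inter> S)"
  have sin: "s \<in> {a..n} \<inter> S"
    unfolding s_def using \<open>{a..n} \<inter> S \<noteq> {}\<close> by (intro Max_in) auto
  have "t \<le> s" if "t \<in> S" "t \<in> {s<..n}" for t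
    unfolding s_def using that sin by (intro Max_ge) auto
  \<comment> \<open>Otherwise the maximal function would attain its upper bound 1 at
    \<open>n + 1\<close>, leaving no room for a descent.\<close>
  moreover have "n + 1 \<notin> S"
    using assms maximal_indicator_lower[of "n + 1" S 0] maximal_indicator_le_1[of S n] by force
  ultimately have "{s<..n + 1} \<inter> S = {}"
    by (force simp: le_less zless_add1_eq)
  then show ?thesis using sin by auto
qed

text \<open>Each descent is charged to the last point of $S$ before it, which is the left end of a
  boundary edge of $S$.\<close>
lemma sum_descents_le:
  fixes S :: "int set"
  defines "M \<equiv> maximal (indicator S)"
  assumes p: "1 < p" and F: "finite F" and desc: "\<And>n. n \<in> F \<Longrightarrow> M (n + 1) < M n"
  shows "\<exists>G. finite G \<and> G \<subseteq> {s. s \<in> S \<and> s + 1 \<notin> S} \<and>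
    (\<Sum>n\<in>F. \<bar>dderiv M n\<bar> powr p) \<le> (\<Sum>j. delta_slope j powr p) * card G"
proof -
  have "\<forall>n\<in>F. \<exists>s. s \<in> S \<and> s \<le> n \<and> {s<..n + 1} \<inter> S = {}"
    using last_point_before_descent desc by (fastforce simp: M_def)
  then obtain s where s: "\<And>n. n \<in> F \<Longrightarrow> s n \<in> S \<and> s n \<le> n \<and> {s n<..n + 1} \<inter> S = {}"
    by metis
  have "(\<Sum>n\<in>{n \<in> F. s n = t}. \<bar>dderiv M n\<bar> powr p) \<le> (\<Sum>j. delta_slope j powr p)"
    if t: "t \<in> s ` F" for t
  proof -
    define A where "A = {n \<in> F. s n = t}"
    have A: "finite A" "A \<noteq> {}" using t F by (auto simp: A_def)
    \<comment> \<open>The run of \<open>L\<close> steps from \<open>t\<close> ends with the last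
      descent charged to \<open>t\<close>, which supplies the descent at the final step that
      \<open>sum_descent_le\<close> asks for.\<close>
    define L where "L = nat (Max A + 1 - t)"
    have "Max A \<in> A" using A by simp
    then have mx: "Max A \<in> F" "s (Max A) = t" by (auto simp: A_def)
    have L: "t + int L = Max A + 1" using s[OF mx(1)] mx by (simp add: L_def)
    have "(\<Sum>n\<in>A. \<bar>dderiv M n\<bar> powr p) \<le> (\<Sum>n\<in>(\<lambda>j. t + int j) ` {..<L}. \<bar>dderiv M n\<bar> powr p)"
    proof (intro sum_mono2)
      show "A \<subseteq> (\<lambda>j. t + int j) ` {..<L}"
      proof
        fix n assume n: "n \<in> A"
        then have "t \<le> n" using s by (auto simp: A_def)
        moreover have "n \<le> Max A" using n A by simp
        ultimately have "n = t + int (nat (n - t))" "nat (n - t) < L"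
          using L by (auto simp: L_def)
        then show "n \<in> (\<lambda>j. t + int j) ` {..<L}" by blast
      qed
    qed auto
    also have "\<dots> = (\<Sum>j<L. \<bar>dderiv M (t + int j)\<bar> powr p)"
      by (subst sum.reindex) (auto simp: inj_on_def)
    also have "\<dots> \<le> (\<Sum>j<L. delta_slope j powr p)"
      unfolding M_def using s[OF mx(1)] mx desc[OF mx(1)] L
      by (intro sum_descent_le p) (auto simp: M_def)
    also have "\<dots> \<le> (\<Sum>j. delta_slope j powr p)"
      by (intro sum_le_suminf summable_delta_slope_powr p) auto
    finally show ?thesis by (simp add: A_def)
  qed
  then have "(\<Sum>t\<in>s ` F. \<Sum>n\<in>{n \<in> F. s n = t}. \<bar>dderiv M n\<bar> powr p)
      \<le> (\<Sum>t\<in>s ` F. \<Sum>j. delta_slope j powr p)"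
    by (intro sum_mono)
  also have "(\<Sum>t\<in>s ` F. \<Sum>n\<in>{n \<in> F. s n = t}. \<bar>dderiv M n\<bar> powr p)
      = (\<Sum>n\<in>F. \<bar>dderiv M n\<bar> powr p)"
    using F by (intro sum.image_gen[symmetric])
  finally have "(\<Sum>n\<in>F. \<bar>dderiv M n\<bar> powr p) \<le> (\<Sum>j. delta_slope j powr p) * card (s ` F)"
    by (simp add: mult.commute)
  moreover have "s ` F \<subseteq> {s. s \<in> S \<and> s + 1 \<notin> S}"
  proof
    fix t assume "t \<in> s ` F"
    then obtain n where n: "n \<in> F" "t = s n" by blast
    then have "t + 1 \<in> {t<..n + 1}" using s[of n] by auto
    then show "t \<in> {s. s \<in> S \<and> s + 1 \<notin> S}" using s[of n] n by blast
  qed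
  ultimately show ?thesis using F by blast
qed

text \<open>Descents are charged to falling edges of \<open>S\<close>. Ascents are descents for the
  reflected set and are thus charged to rising edges. Each edge contributes exactly 1 to the sum on
  the right.\<close>

lemma sum_dderiv_maximal_indicator_le:
  fixes S :: "int set"
  assumes p: "1 < p" and F: "finite F"
  shows "\<exists>G. finite G \<and> (\<Sum>n\<in>F. \<bar>dderiv (maximal (indicator S)) n\<bar> powr p)
    \<le> (\<Sum>j. delta_slope j powr p) * (\<Sum>n\<in>G. \<bar>dderiv (indicator S) n\<bar> powr p)"
proof -
  define K where "K = (\<Sum>j. delta_slope j powr p)"
  define M :: "int \<Rightarrow> real" where "M = maximal (indicator S)"
  define M' :: "int \<Rightarrow> real" where "M' = maximal (indicator (uminus ` S))"
  \<comment> \<open>A difference is indexed by the left end of the pair \<open>n\<close>,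
    \<open>n + 1\<close>; reflection sends this pair to one with left end
    \<open>- n - 1\<close>.\<close>
  define r where "r n = - n - 1" for n :: int
  have r: "r (r n) = n" "inj_on r A" for n A
    by (auto simp: r_def inj_on_def)
  have reflect: "i \<in> uminus ` S \<longleftrightarrow> - i \<in> S" for i
    by force
  then have "(indicator (uminus ` S) :: int \<Rightarrow> real) = (\<lambda>i. indicator S (- i))"
    by (simp add: indicator_def fun_eq_iff)
  then have M': "M' n = M (- n)" for n
    by (simp add: M'_def M_def maximal_reflect)
  have dM': "\<bar>dderiv M' (r n)\<bar> = \<bar>dderiv M n\<bar>" for n
  proof -
    have "dderiv M' (r n) = - dderiv M n"
      by (simp add: dderiv_def M' r_def add.commute[of 1 n])
    then show ?thesis by simp
  qed
  define F1 where "F1 = {n \<in> F. M (n + 1) < M n}"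
  define F2 where "F2 = {n \<in> F. M n < M (n + 1)}"
  have "finite F1" "\<And>n. n \<in> F1 \<Longrightarrow> M (n + 1) < M n"
    using F by (auto simp: F1_def)
  then obtain G1 where G1: "finite G1" "G1 \<subseteq> {s. s \<in> S \<and> s + 1 \<notin> S}"
    "(\<Sum>n\<in>F1. \<bar>dderiv M n\<bar> powr p) \<le> K * card G1"
    unfolding M_def K_def using sum_descents_le[OF p, of F1 S] by blast
  have "M' (n + 1) < M' n" if "n \<in> r ` F2" for n
    using that by (auto simp: F2_def M' r_def add.commute)
  moreover have "finite (r ` F2)"
    using F by (simp add: F2_def)
  ultimately obtain G2 where G2: "finite G2" "G2 \<subseteq> {s. s \<in> uminus ` S \<and> s + 1 \<notin> uminus ` S}"
    "(\<Sum>n\<in>r ` F2. \<bar>dderiv M' n\<bar> powr p) \<le> K * card G2"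
    unfolding M'_def K_def using sum_descents_le[OF p, of "r ` F2" "uminus ` S"] by blast
  have G2': "r ` G2 \<subseteq> {s. s \<notin> S \<and> s + 1 \<in> S}"
    using G2(2) by (auto simp: r_def reflect)
  have "(\<Sum>n\<in>F. \<bar>dderiv M n\<bar> powr p) = (\<Sum>n\<in>F1 \<union> F2. \<bar>dderiv M n\<bar> powr p)"
    using F by (intro sum.mono_neutral_right) (auto simp: F1_def F2_def dderiv_def)
  also have "\<dots> = (\<Sum>n\<in>F1. \<bar>dderiv M n\<bar> powr p) + (\<Sum>n\<in>F2. \<bar>dderiv M n\<bar> powr p)"
    using F by (intro sum.union_disjoint) (auto simp: F1_def F2_def)
  also have "(\<Sum>n\<in>F2. \<bar>dderiv M n\<bar> powr p) = (\<Sum>n\<in>r ` F2. \<bar>dderiv M' n\<bar> powr p)"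
    by (simp add: sum.reindex r dM')
  also have "(\<Sum>n\<in>F1. \<bar>dderiv M n\<bar> powr p) + \<dots> \<le> K * (real (card G1) + real (card G2))"
    using G1(3) G2(3) by (simp add: distrib_left)
  \<comment> \<open>No edge is both falling and rising, so the union is disjoint.\<close>
  also have "real (card G1) + real (card G2) = real (card (G1 \<union> r ` G2))"
    using G1 G2 G2' r by (subst card_Un_disjoint) (auto simp: card_image)
  also have "\<dots> = (\<Sum>n\<in>G1 \<union> r ` G2. \<bar>dderiv (indicator S) n\<bar> powr p)"
  proof -
    have "\<bar>dderiv (indicator S) n\<bar> powr p = 1" if "n \<in> G1 \<union> r ` G2" for n
      using that G1(2) G2' by (auto simp: dderiv_def)
    then show ?thesis by simp
  qed
  finally show ?thesis
    using G1(1) G2(1) by (intro exI[of _ "G1 \<union> r ` G2"]) (simp add: M_def K_def)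
qed

text \<open>Every finite sum on the left is at most \<open>K\<close> times a finite sum on the
  right, hence at most \<open>K * N\<close>; p-th roots make \<open>K powr (1 / p)\<close>
  admissible in the infimum.\<close>

lemma C_char_le:
  assumes "1 < p"
  shows "C_char p \<le> ennreal ((\<Sum>j. delta_slope j powr p) powr (1 / p))"
  unfolding C_char_def
proof (intro Inf_lower CollectI allI impI)
  fix S :: "int set"
  define K where "K = (\<Sum>j. delta_slope j powr p)"
  define g :: "int \<Rightarrow> real" where "g = dderiv (indicator S)"
  define N where "N = (\<Sum>\<^sub>\<infinity>n. \<bar>g n\<bar> powr p)"
  assume "lp_norm p (dderiv (indicator S)) < \<infinity>"
  then have s: "(\<lambda>n. \<bar>g n\<bar> powr p) summable_on UNIV"
    by (auto simp: lp_norm_def g_def split: if_splits)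
  have K: "K \<ge> 0" using assms summable_delta_slope_powr by (auto simp: K_def intro!: suminf_nonneg)
  have N: "N \<ge> 0" by (simp add: N_def infsum_nonneg)
  have "(\<Sum>n\<in>F. \<bar>dderiv (maximal (indicator S)) n\<bar> powr p) \<le> K * N" if F: "finite F" for F
  proof -
    obtain G where G: "finite G" "(\<Sum>n\<in>F. \<bar>dderiv (maximal (indicator S)) n\<bar> powr p)
        \<le> K * (\<Sum>n\<in>G. \<bar>g n\<bar> powr p)"
      using sum_dderiv_maximal_indicator_le[OF assms F, of S] by (auto simp: K_def g_def)
    have "(\<Sum>n\<in>G. \<bar>g n\<bar> powr p) \<le> N"
      unfolding N_def using s G by (intro finite_sum_le_infsum) auto
    then have "K * (\<Sum>n\<in>G. \<bar>g n\<bar> powr p) \<le> K * N"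
      using K by (rule mult_left_mono)
    then show ?thesis using G by simp
  qed
  then have "lp_norm p (dderiv (maximal (indicator S))) \<le> ennreal ((K * N) powr (1 / p))"
    using assms K N by (subst lp_norm_le_iff) auto
  also have "\<dots> = ennreal (K powr (1 / p)) * lp_norm p g"
    using s by (simp add: lp_norm_def N_def powr_mult ennreal_mult)
  finally show "lp_norm p (dderiv (maximal (indicator S)))
      \<le> ennreal ((\<Sum>j. delta_slope j powr p) powr (1 / p)) * lp_norm p (dderiv (indicator S))"
    by (simp add: K_def g_def)
qed

section \<open>The perturbed point mass and its maximal function\<close>

definition bump :: "real \<Rightarrow> int \<Rightarrow> real" where
  "bump e i = (if i = 0 then 1 else if \<bar>i\<bar> = 1 then e else 0)"

context
  fixes e :: real
  assumes e: "0 < e" "e < 1"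
begin

lemma bump_nonneg: "bump e i \<ge> 0" and bump_le_1: "bump e i \<le> 1"
  using e by (auto simp: bump_def)

lemma maximal_finite_bump: "maximal_finite (bump e)"
  by (rule maximal_finite_bounded[of _ 1]) (simp add: bump_nonneg bump_le_1)

lemma avg_bump_le:
  assumes "a \<le> b" "{a..b} \<inter> {-1, 0, 1} \<subseteq> T" "finite T"
  shows "avg (bump e) {a..b} \<le> sum (bump e) T / real_of_int (b - a + 1)"
proof -
  have "sum (bump e) {a..b} = sum (bump e) ({a..b} \<inter> {-1, 0, 1})"
    by (intro sum.mono_neutral_right) (auto simp: bump_def)
  also have "\<dots> \<le> sum (bump e) T"
    using assms by (intro sum_mono2) (auto simp: bump_nonneg)
  finally show ?thesis
    using assms(1) by (auto simp: avg_def bump_nonneg intro!: divide_right_mono)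
qed

lemma avg_bump_ge:
  assumes "T \<subseteq> {a..b}" "a \<le> b"
  shows "sum (bump e) T / real_of_int (b - a + 1) \<le> avg (bump e) {a..b}"
proof -
  have "sum (bump e) T \<le> sum (bump e) {a..b}"
    using assms by (intro sum_mono2) (auto simp: bump_nonneg)
  then show ?thesis
    using assms(2) by (auto simp: avg_def bump_nonneg intro!: divide_right_mono)
qed

lemma maximal_bump_0: "maximal (bump e) 0 = 1"
proof (rule antisym)
  show "maximal (bump e) 0 \<le> 1"
    by (intro maximal_leI avg_le_bound) (simp add: bump_nonneg bump_le_1)
  show "1 \<le> maximal (bump e) 0"
    using avg_le_maximal[OF maximal_finite_bump, of 0 0 0] by (simp add: avg_def bump_def)
qed

lemma maximal_bump_reflect: "maximal (bump e) (- n) = maximal (bump e) n"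
proof -
  have "(\<lambda>i. bump e (- i)) = bump e" by (auto simp: bump_def)
  then show ?thesis using maximal_reflect[of "bump e" n] by simp
qed

text \<open>Intervals are sorted by their left end. Reaching -1 captures mass at most
  \<open>1 + 2 * e\<close> with at least \<open>k + 2\<close> points, starting at 0 captures at most
  \<open>1 + e\<close> with at least \<open>k + 1\<close> points, and starting further right never
  does better.\<close>

lemma maximal_bump:
  assumes "k \<ge> 1"
  shows "maximal (bump e) (int k) = max ((1 + e) / (real k + 1)) ((1 + 2 * e) / (real k + 2))"
    (is "_ = max ?A ?B")
proof (rule antisym)
  show "maximal (bump e) (int k) \<le> max ?A ?B"
  proof (rule maximal_leI)
    fix a b assume ab: "a \<le> int k" "int k \<le> b"
    consider "a \<le> -1" | "a = 0" | "a = 1" | "a \<ge> 2" by linarith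
    then show "avg (bump e) {a..b} \<le> max ?A ?B"
    proof cases
      case 1
      have "avg (bump e) {a..b} \<le> sum (bump e) {-1, 0, 1} / real_of_int (b - a + 1)"
        using ab by (intro avg_bump_le) auto
      also have "\<dots> \<le> ?B"
        using ab 1 e by (auto simp: bump_def intro!: divide_mono)
      finally show ?thesis by simp
    next
      case 2
      have "avg (bump e) {a..b} \<le> sum (bump e) {0, 1} / real_of_int (b - a + 1)"
        using ab 2 by (intro avg_bump_le) auto
      also have "\<dots> \<le> ?A"
        using ab 2 e by (auto simp: bump_def intro!: divide_mono)
      finally show ?thesis by simp
    next
      case 3
      have "avg (bump e) {a..b} \<le> sum (bump e) {1} / real_of_int (b - a + 1)"
        using ab 3 by (intro avg_bump_le) auto
      also have "\<dots> \<le> e / real k"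
        using ab 3 e assms by (auto simp: bump_def intro!: divide_mono)
      also have "\<dots> \<le> ?A"
      proof -
        \<comment> \<open>Cross-multiplied, the claim reads \<open>e \<le> real k\<close>.\<close>
        have "e * 1 \<le> 1 * real k" using e assms by (intro mult_mono) auto
        then show ?thesis using assms by (simp add: divide_simps algebra_simps)
      qed
      finally show ?thesis by simp
    next
      case 4
      have "avg (bump e) {a..b} \<le> sum (bump e) {} / real_of_int (b - a + 1)"
        using ab 4 by (intro avg_bump_le) auto
      also have "\<dots> \<le> ?A" using e by simp
      finally show ?thesis by simp
    qed
  qed
  have "?A \<le> avg (bump e) {0..int k}"
    using avg_bump_ge[of "{0, 1}" 0 "int k"] assms by (simp add: bump_def)
  moreover have "?B \<le> avg (bump e) {-1..int k}"
    using avg_bump_ge[of "{-1, 0, 1}" "-1" "int k"] assms by (simp add: bump_def add_ac)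
  ultimately show "max ?A ?B \<le> maximal (bump e) (int k)"
    using avg_le_maximal[OF maximal_finite_bump, of 0 "int k" "int k"]
      avg_le_maximal[OF maximal_finite_bump, of "-1" "int k" "int k"] by simp
qed

text \<open>At 1 the first of the two values in \<open>maximal_bump\<close> is the larger one,
  because \<open>e < 1\<close>.\<close>

lemma dderiv_maximal_bump_0: "\<bar>dderiv (maximal (bump e)) 0\<bar> = (1 - e) / 2"
  using maximal_bump[of 1] maximal_bump_0 e by (simp add: dderiv_def max_def divide_simps)

text \<open>The decrement of a maximum of two sequences is at least that of the sequence which is
  larger at \<open>Suc k\<close>. So it suffices to bound the decrement of that sequence, in either
  case.\<close>

lemma dderiv_maximal_bump_ge:
  assumes "k \<ge> 1"
  shows "delta_slope k \<le> \<bar>dderiv (maximal (bump e)) (int k)\<bar>"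
proof -
  let ?A = "\<lambda>k. (1 + e) / (real k + 1)" and ?B = "\<lambda>k. (1 + 2 * e) / (real k + 2)"
  have d: "dderiv (maximal (bump e)) (int k) = max (?A (Suc k)) (?B (Suc k)) - max (?A k) (?B k)"
    using maximal_bump[of k] maximal_bump[of "Suc k"] assms by (simp add: dderiv_def add.commute)
  show ?thesis
  proof (cases "?B (Suc k) \<le> ?A (Suc k)")
    case True
    have "delta_slope k \<le> (1 + e) * delta_slope k"
      using e delta_slope_pos[of k] by (simp add: distrib_right)
    also have "\<dots> = ?A k - ?A (Suc k)"
      by (simp add: delta_slope_eq right_diff_distrib add.commute)
    finally show ?thesis using d True by linarith
  next
    case False
    then have "e * (real k + 1) > 1"
      by (simp add: divide_simps algebra_simps)
    \<comment> \<open>The left side is the ratio of \<open>delta_slope k\<close> to 1 / ((k + 2) (k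
      + 3)), the decrement of \<open>?B\<close> without its factor \<open>1 + 2 * e\<close>.\<close>
    then have "(real k + 3) / (real k + 1) \<le> 1 + 2 * e"
      by (simp add: divide_simps algebra_simps)
    then have "(real k + 3) / (real k + 1) / ((real k + 2) * (real k + 3))
        \<le> (1 + 2 * e) / ((real k + 2) * (real k + 3))"
      by (intro divide_right_mono) auto
    also have "\<dots> = ?B k - ?B (Suc k)"
      by (simp add: divide_simps) (simp add: algebra_simps)
    also have "(real k + 3) / (real k + 1) / ((real k + 2) * (real k + 3)) = delta_slope k"
      by (simp add: delta_slope_def)
    finally show ?thesis using d False by linarith
  qed
qed

text \<open>The half-open window is the one invariant under the reflection of differences, which
  sends \<open>n\<close> to \<open>- n - 1\<close>.\<close>

lemma sum_dderiv_maximal_bump: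
  "(\<Sum>n\<in>{- int k..<int k}. \<bar>dderiv (maximal (bump e)) n\<bar> powr p)
    = 2 * (\<Sum>j<k. \<bar>dderiv (maximal (bump e)) (int j)\<bar> powr p)"
proof (induction k)
  case (Suc k)
  have "{- int (Suc k)..<int (Suc k)} = insert (- int k - 1) (insert (int k) {- int k..<int k})"
    by auto
  moreover have "\<bar>dderiv (maximal (bump e)) (- int k - 1)\<bar> = \<bar>dderiv (maximal (bump e)) (int k)\<bar>"
    using maximal_bump_reflect[of "int k"] maximal_bump_reflect[of "int k + 1"]
    by (simp add: dderiv_def)
  ultimately show ?case using Suc by simp
qed simp

lemma lp_norm_dderiv_bump_le:
  assumes "p > 0"
  shows "lp_norm p (dderiv (bump e)) \<le> ennreal ((2 * ((1 - e) powr p + e powr p)) powr (1 / p))"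
proof (subst lp_norm_le_iff)
  show "\<forall>F. finite F \<longrightarrow> (\<Sum>n\<in>F. \<bar>dderiv (bump e) n\<bar> powr p) \<le> 2 * ((1 - e) powr p + e powr p)"
  proof (intro allI impI)
    fix F :: "int set" assume "finite F"
    \<comment> \<open>The only nonzero differences are \<open>e\<close>, \<open>1 - e\<close>,
      \<open>e - 1\<close>, \<open>- e\<close>, at -2, -1, 0, 1.\<close>
    then have "(\<Sum>n\<in>F. \<bar>dderiv (bump e) n\<bar> powr p)
        = (\<Sum>n\<in>F \<inter> {-2, -1, 0, 1}. \<bar>dderiv (bump e) n\<bar> powr p)"
      by (intro sum.mono_neutral_right) (auto simp: dderiv_def bump_def)
    also have "\<dots> \<le> (\<Sum>n\<in>{-2, -1, 0, 1}. \<bar>dderiv (bump e) n\<bar> powr p)"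
      by (intro sum_mono2) auto
    also have "\<dots> = 2 * ((1 - e) powr p + e powr p)"
      using e by (simp add: dderiv_def bump_def)
    finally show "(\<Sum>n\<in>F. \<bar>dderiv (bump e) n\<bar> powr p) \<le> 2 * ((1 - e) powr p + e powr p)" .
  qed
qed (use assms in auto)

end

section \<open>Comparison of the two constants\<close>

theorem theorem2p4:
  fixes p :: real
  assumes "1 < p"
  shows "C_unc p > C_char p"
proof (rule ccontr)
  define K where "K = (\<Sum>j. delta_slope j powr p)"
  \<comment> \<open>The tail omits the first slope 1/2, the only one that the perturbation
    diminishes.\<close>
  define R where "R = (\<Sum>j. delta_slope (Suc j) powr p)"
  note summ = summable_delta_slope_powr[OF assms]
  have summ': "summable (\<lambda>j. delta_slope (Suc j) powr p)"
    using summ by (subst summable_Suc_iff)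
  have R: "R > 0"
    unfolding R_def using summ'
    by (intro suminf_pos) (auto simp: delta_slope_pos less_imp_neq[symmetric])
  have K_eq: "K = (1 / 2) powr p + R"
    using suminf_split_head[OF summ] by (simp add: K_def R_def delta_slope_def)
  then have K: "K > 0" using R by (simp add: add_nonneg_pos)
  \<comment> \<open>The parameter must satisfy \<open>K * e powr p < R * e\<close>, that is
    \<open>e powr (p - 1) < R / K\<close>; since \<open>p > 1\<close>, every small positive
    \<open>e\<close> does.\<close>
  have "((\<lambda>e. e powr (p - 1)) \<longlongrightarrow> 0 powr (p - 1)) (at_right 0)"
    using assms by (intro tendsto_intros) (auto simp: eventually_at_filter)
  then have "\<forall>\<^sub>F e in at_right 0. e powr (p - 1) < R / K"
    using R K by (intro order_tendstoD(2)) auto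
  moreover have "\<forall>\<^sub>F e in at_right 0. e \<in> {0<..<1::real}"
    by (rule eventually_at_right_real) simp
  ultimately have "\<forall>\<^sub>F e in at_right 0. e powr (p - 1) < R / K \<and> e \<in> {0<..<1}"
    by eventually_elim simp
  then have "\<exists>e. e powr (p - 1) < R / K \<and> e \<in> {0<..<1}"
    by (rule eventually_happens'[OF trivial_limit_at_right_real])
  then obtain e where e: "0 < e" "e < 1" and small: "e powr (p - 1) < R / K"
    by auto
  define f where "f = bump e"
  define B where "B = 2 * ((1 - e) powr p + e powr p)"
  have B: "B \<ge> 0" by (simp add: B_def)
  assume "\<not> C_unc p > C_char p"
  then have le: "C_unc p \<le> ennreal (K powr (1 / p))"
    using C_char_le[OF assms] unfolding K_def by (meson not_less order_trans)
  have f': "lp_norm p (dderiv f) \<le> ennreal (B powr (1 / p))"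
    using lp_norm_dderiv_bump_le[OF e, of p] assms by (simp add: f_def B_def)
  then have "lp_norm p (dderiv f) < \<infinity>"
    by (simp add: le_less_trans)
  then have "lp_norm p (dderiv (maximal f)) \<le> C_unc p * lp_norm p (dderiv f)"
    unfolding f_def by (intro C_unc_bound maximal_finite_bump e)
  also have "\<dots> \<le> ennreal (K powr (1 / p)) * ennreal (B powr (1 / p))"
    using le f' by (intro mult_mono) auto
  also have "\<dots> = ennreal ((K * B) powr (1 / p))"
    by (simp add: powr_mult ennreal_mult)
  finally have fin: "\<forall>F. finite F \<longrightarrow> (\<Sum>n\<in>F. \<bar>dderiv (maximal f) n\<bar> powr p) \<le> K * B"
    using assms K B by (subst (asm) lp_norm_le_iff) auto
  \<comment> \<open>By evenness the sum over nonnegative indices is half of a symmetric one. Its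
    first term is known exactly, the others are at least the slopes of the point mass.\<close>
  have "((1 - e) / 2) powr p + (\<Sum>j<k. delta_slope (Suc j) powr p) \<le> K * B / 2" for k
  proof -
    have "((1 - e) / 2) powr p + (\<Sum>j<k. delta_slope (Suc j) powr p)
        \<le> (\<Sum>j<Suc k. \<bar>dderiv (maximal f) (int j)\<bar> powr p)"
      unfolding sum.lessThan_Suc_shift f_def using assms
      by (intro add_mono sum_mono powr_mono2 dderiv_maximal_bump_ge e)
        (use e in \<open>auto simp: dderiv_maximal_bump_0 delta_slope_pos less_imp_le\<close>)
    also have "\<dots> = (\<Sum>n\<in>{- int (Suc k)..<int (Suc k)}. \<bar>dderiv (maximal f) n\<bar> powr p) / 2"
      unfolding f_def by (subst sum_dderiv_maximal_bump[OF e]) simp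
    also have "\<dots> \<le> K * B / 2"
      using fin by (intro divide_right_mono) auto
    finally show ?thesis .
  qed
  then have "R \<le> K * B / 2 - ((1 - e) / 2) powr p"
    unfolding R_def using summ'
    by (intro suminf_le_const) (auto simp: le_diff_eq add.commute)
  moreover have "((1 - e) / 2) powr p = (1 / 2) powr p * (1 - e) powr p"
    using e by (simp add: powr_divide)
  moreover have "K * B / 2 = K * (1 - e) powr p + K * e powr p"
    by (simp add: B_def distrib_left)
  ultimately have "R \<le> K * (1 - e) powr p + K * e powr p - (1 / 2) powr p * (1 - e) powr p"
    by simp
  moreover have "K * (1 - e) powr p = (1 / 2) powr p * (1 - e) powr p + R * (1 - e) powr p"
    unfolding K_eq by (rule distrib_right)
  ultimately have "R \<le> R * (1 - e) powr p + K * e powr p"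
    by linarith
  \<comment> \<open>Since \<open>1 - e\<close> lies between 0 and 1, its p-th power is at most
    itself. With the choice of \<open>e\<close> the right-hand side falls below
    \<open>R * (1 - e) + R * e = R\<close>, a contradiction.\<close>
  moreover have "R * (1 - e) powr p \<le> R * (1 - e)"
    using R e assms powr_mono'[of 1 p "1 - e"] by (intro mult_left_mono) auto
  moreover have "K * e powr p < R * e"
    using small K e by (simp add: powr_diff pos_less_divide_eq mult.commute field_simps)
  ultimately show False by (simp add: right_diff_distrib)
qed

end
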